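(* Let $\boldsymbol{g}=(g_1,\ldots,g_n)'\in R_{\boldsymbol{B}}$ where the index matrix $\boldsymbol{B}\in\mathbb{R}^{n\times n}$ has zero diagonal. Let $f\in\Pi(\boldsymbol{g})$ with $\boldsymbol{g}$-index $\boldsymbol{c}=(c_1,\ldots,c_n)$. Put $\Delta^0f(t)=f(t)$, $\Delta^kf(t)=\Delta^{k-1}f(et)-\Delta^{k-1}f(t)$ for $k\in\{1,2,\ldots\}$, where $e=\exp(1)$, and write $\boldsymbol{\Delta}=(\Delta f,\Delta^2f,\ldots,\Delta^nf)'$. (a) There exists an upper triangular matrix $\boldsymbol{Q}\in\mathbb{R}^{n\times n}$ such that $$\boldsymbol{\Delta}(t)=\boldsymbol{Q}\boldsymbol{g}(t)+o(g_n(t)),\qquad t\to\infty.$$ (b) For $i\in\{0,1,\ldots,n\}$ and $x\in(0,\infty)$, $$\Delta^if(xt)=\sum_{j=i}^n\binom{\log x}{j-i}\Delta^jf(t)+o(g_n(t)),\qquad t\to\infty.$$ (c) The matrix $\boldsymbol{Q}$ in (a) is invertible if and only if $c_1\prod_{i=1}^{n-1}B_{i,i+1}\neq0$. In this case, $\boldsymbol{\Delta}$ is a regularly varying rate vector with index matrix $\boldsymbol{M}\in\mathbb{R}^{n\times n}$, the triangular Toeplitz matrix whose non-zero elements are given by $$M_{ij}=\frac{(-1)^{j-i-1}}{j-i},\qquad1\leq i<j\leq n,$$ and $f\in\Pi(\boldsymbol{\Delta})$ with $\boldsymbol{\Delta}$-index $(1,-1/2,1/3,\ldots,(-1)^{n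-1}/n)$.
   Context: For real $z$ and integer $k\geq1$, $\binom{z}{0}=1$ and $\binom{z}{k}=z(z-1)\cdots(z-k+1)/k!$. Limit relations are as $t\to\infty$; measurability is Lebesgue; an empty product equals $1$. A real function is defined in a neighbourhood of infinity if its domain contains some $[t_0,\infty)$; it is eventually of constant sign if it is either strictly positive for all large $t$ or strictly negative for all large $t$. A rate vector of length $n$ is a column vector $\boldsymbol{g}=(g_1,\ldots,g_n)'$ of real-valued functions defined in a neighbourhood of infinity, each eventually of constant sign, with $g_{i+1}(t)=o(g_i(t))$ for every $i\in\{1,\ldots,n-1\}$; $o(g_n(t))$ means $o(|g_n(t)|)$, componentwise for vectors. For a square matrix $\boldsymbol{B}$ and $x>0$, $x^{\boldsymbol{B}}=\exp\{(\log x)\boldsymbol{B}\}$. An index matrix is an upper triangular $\boldsymbol{B}\in\mathbb{R}^{n\times n}$ whose diagonal elements are non-increasing and all of whose eigenvalues, except possibly the smallest one, have geometric multiplicity one. A rate vector $\boldsymbol{g}$ belongs to $R_{\boldsymbol{B}}$ (is regularly varying with index matrix $\boldsymbol{B}$) if $\boldsymbol{g}$ is measurable and $\boldsymbol{g}(xt)=x^{\boldsymbol{B}}\boldsymbol{g}(t)+o(g_n(t))$ for every $x\in(0,\infty)$. For $\boldsymbol{g}\in R_{\boldsymbol{B}}$ with $\boldsymbol{B}$ having zero diagonal, $f\in\Pi(\boldsymbol{g})$ with $\boldsymbol{g}$-index $\boldsymbol{c}\in\mathbb{R}^{1\times n}$ means that $f$ is a measurable real-valued function defined in a neighbourhood of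 infinity and for every $x\in(0,\infty)$, $f(xt)=f(t)+\boldsymbol{h}(x)\boldsymbol{g}(t)+o(g_n(t))$ with $\boldsymbol{h}(x)=\boldsymbol{c}\int_1^x y^{\boldsymbol{B}}y^{-1}\,\mathrm{d}y$. *)

theory Defs
  imports
    "HOL-Analysis.Analysis"
    "HOL-Library.Landau_Symbols"
    "Jordan_Normal_Form.Jordan_Normal_Form_Uniqueness"
begin

no_notation Finite_Cartesian_Product.vec_nth (infixl \<open>$\<close> 90)
no_notation Inner_Product.inner (infix \<open>\<bullet>\<close> 70)
hide_type (open) Finite_Cartesian_Product.vec
hide_const (open) Finite_Cartesian_Product.vec Finite_Cartesian_Product.mat

text \<open>
  Vectors and matrices are those of \<^theory>\<open>Jordan_Normal_Form.Matrix\<close>, with indices starting at 0: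
  the entry with mathematical index \<open>i\<close> (or \<open>(i, j)\<close>) is \<open>v $ (i - 1)\<close> (or \<open>A $$ (i - 1, j - 1)\<close>).
  The length \<open>n\<close> is always at least 1, and the last component of a vector is \<open>v $ (n - 1)\<close>.

  A partial function on the reals is represented by a total function together with its
  domain \<open>D\<close>; values outside \<open>D\<close> are irrelevant. The domain of a vector of functions is the set
  on which all components are defined.
\<close>

definition nbhd_of_infinity :: "real set \<Rightarrow> bool" where
  "nbhd_of_infinity D \<longleftrightarrow> (\<exists>t0. {t0..} \<subseteq> D)"

definition lebesgue_measurable_fun :: "real set \<Rightarrow> (real \<Rightarrow> real) \<Rightarrow> bool" where
  "lebesgue_measurable_fun D f \<longleftrightarrow> D \<in> sets lebesgue \<and> f \<in> borel_measurable (lebesgue_on D)"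

definition eventually_constant_sign :: "(real \<Rightarrow> real) \<Rightarrow> bool" where
  "eventually_constant_sign f \<longleftrightarrow>
     (\<forall>\<^sub>F t in at_top. f t > 0) \<or> (\<forall>\<^sub>F t in at_top. f t < 0)"

definition vec_smallo :: "nat \<Rightarrow> (real \<Rightarrow> real vec) \<Rightarrow> (real \<Rightarrow> real) \<Rightarrow> bool" where
  "vec_smallo n F h \<longleftrightarrow> (\<forall>i<n. (\<lambda>t. F t $ i) \<in> o[at_top](h))"

definition rate_vector :: "nat \<Rightarrow> real set \<Rightarrow> (real \<Rightarrow> real vec) \<Rightarrow> bool" where
  "rate_vector n D g \<longleftrightarrow>
     nbhd_of_infinity D \<and>
     (\<forall>t\<in>D. g t \<in> carrier_vec n) \<and>
     (\<forall>i<n. eventually_constant_sign (\<lambda>t. g t $ i)) \<and>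
     (\<forall>i. i + 1 < n \<longrightarrow> (\<lambda>t. g t $ (i + 1)) \<in> o[at_top](\<lambda>t. g t $ i))"

definition mat_exp :: "real mat \<Rightarrow> real mat" where
  "mat_exp A = mat (dim_row A) (dim_col A) (\<lambda>(i, j). \<Sum>k. (A ^\<^sub>m k) $$ (i, j) / fact k)"

definition mat_powr :: "real \<Rightarrow> real mat \<Rightarrow> real mat" where
  "mat_powr x B = mat_exp (ln x \<cdot>\<^sub>m B)"

definition geometric_multiplicity :: "real mat \<Rightarrow> real \<Rightarrow> nat" where
  "geometric_multiplicity B ev = kernel_dim (char_matrix B ev)"

text \<open>The eigenvalues of an upper triangular real matrix are its diagonal entries, so it is enough to
  speak of real eigenvalues. An eigenvalue is not the smallest one iff some eigenvalue is below it.\<close>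

definition index_matrix :: "nat \<Rightarrow> real mat \<Rightarrow> bool" where
  "index_matrix n B \<longleftrightarrow>
     B \<in> carrier_mat n n \<and>
     upper_triangular B \<and>
     (\<forall>i j. i \<le> j \<and> j < n \<longrightarrow> B $$ (j, j) \<le> B $$ (i, i)) \<and>
     (\<forall>ev. eigenvalue B ev \<and> (\<exists>ev'. eigenvalue B ev' \<and> ev' < ev) \<longrightarrow>
        geometric_multiplicity B ev = 1)"

definition regularly_varying :: "nat \<Rightarrow> real mat \<Rightarrow> real set \<Rightarrow> (real \<Rightarrow> real vec) \<Rightarrow> bool" where
  "regularly_varying n B D g \<longleftrightarrow>
     index_matrix n B \<and>
     rate_vector n D g \<and>
     (\<forall>i<n. lebesgue_measurable_fun D (\<lambda>t. g t $ i)) \<and>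
     (\<forall>x>0. vec_smallo n (\<lambda>t. g (x * t) - mat_powr x B *\<^sub>v g t) (\<lambda>t. g t $ (n - 1)))"

text \<open>The integral below is oriented, i.e. it is minus the integral over \<open>{x..1}\<close> if \<open>x < 1\<close>.\<close>

definition int_mat_powr :: "nat \<Rightarrow> real mat \<Rightarrow> real \<Rightarrow> real mat" where
  "int_mat_powr n B x =
     mat n n (\<lambda>(i, j). LBINT y=ereal 1..ereal x. mat_powr y B $$ (i, j) * inverse y)"

text \<open>The product of the row vector \<open>c\<close> with a matrix \<open>A\<close>, written \<open>A\<^sup>T *\<^sub>v c\<close> since vectors do not
  distinguish rows from columns.\<close>

definition Pi_rate :: "nat \<Rightarrow> real mat \<Rightarrow> real vec \<Rightarrow> real \<Rightarrow> real vec" where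
  "Pi_rate n B c x = transpose_mat (int_mat_powr n B x) *\<^sub>v c"

text \<open>\<open>Pi_class n B g D f c\<close>: \<open>f\<close> (with domain \<open>D\<close>) belongs to \<open>\<Pi>(g)\<close> with \<open>g\<close>-index \<open>c\<close>. It is meant
  for \<open>g\<close> regularly varying with index matrix \<open>B\<close> having zero diagonal.\<close>

definition Pi_class ::
  "nat \<Rightarrow> real mat \<Rightarrow> (real \<Rightarrow> real vec) \<Rightarrow> real set \<Rightarrow> (real \<Rightarrow> real) \<Rightarrow> real vec \<Rightarrow> bool" where
  "Pi_class n B g D f c \<longleftrightarrow>
     c \<in> carrier_vec n \<and>
     nbhd_of_infinity D \<and>
     lebesgue_measurable_fun D f \<and>
     (\<forall>x>0. (\<lambda>t. f (x * t) - (f t + Pi_rate n B c x \<bullet> g t)) \<in> o[at_top](\<lambda>t. g t $ (n - 1)))"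

primrec Diff :: "nat \<Rightarrow> (real \<Rightarrow> real) \<Rightarrow> real \<Rightarrow> real" where
  "Diff 0 f t = f t"
| "Diff (Suc k) f t = Diff k f (exp 1 * t) - Diff k f t"

text \<open>The domain of \<open>Diff k f\<close> if \<open>f\<close> has domain \<open>D\<close>. It decreases with \<open>k\<close>, so \<open>Diff_dom n D\<close> is the
  domain of \<open>Diff_vec n f\<close>.\<close>

primrec Diff_dom :: "nat \<Rightarrow> real set \<Rightarrow> real set" where
  "Diff_dom 0 D = D"
| "Diff_dom (Suc k) D = {t. exp 1 * t \<in> Diff_dom k D \<and> t \<in> Diff_dom k D}"

definition Diff_vec :: "nat \<Rightarrow> (real \<Rightarrow> real) \<Rightarrow> real \<Rightarrow> real vec" where
  "Diff_vec n f t = vec n (\<lambda>i. Diff (i + 1) f t)"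

definition Diff_expansion :: "nat \<Rightarrow> (real \<Rightarrow> real vec) \<Rightarrow> (real \<Rightarrow> real) \<Rightarrow> real mat \<Rightarrow> bool" where
  "Diff_expansion n g f Q \<longleftrightarrow>
     Q \<in> carrier_mat n n \<and>
     upper_triangular Q \<and>
     vec_smallo n (\<lambda>t. Diff_vec n f t - Q *\<^sub>v g t) (\<lambda>t. g t $ (n - 1))"

text \<open>As the entries depend on \<open>j - i\<close> only, the formula is not affected by the index shift.\<close>

definition Diff_index_mat :: "nat \<Rightarrow> real mat" where
  "Diff_index_mat n =
     mat n n (\<lambda>(i, j). if i < j then (-1) ^ (j - i - 1) / real (j - i) else 0)"

definition Diff_index_vec :: "nat \<Rightarrow> real vec" where
  "Diff_index_vec n = vec n (\<lambda>j. (-1) ^ j / real (j + 1))"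

end

theory Submission
  imports Defs
begin

text \<open>
  Since \<open>B\<close> is nilpotent, the entries of \<open>x\<^bsup>B\<^esup>\<close> and of \<open>h x\<close> are polynomials in \<open>log x\<close>. Modulo
  \<open>o(g\<^sub>n)\<close>, each difference of \<open>f\<close> is therefore a linear combination of the components of \<open>g\<close>, with
  coefficients that are uniquely determined because the components are of different orders of
  magnitude. Taking a difference removes the leading component, as \<open>x\<^bsup>B\<^esup>\<close> is unitriangular: this gives
  (a), the diagonal entries of \<open>Q\<close>, and \<open>\<Delta>\<^bsup>n+1\<^esup>f = o(g\<^sub>n)\<close>. In (b), both sides have coefficients
  polynomial in \<open>log x\<close>, which agree at all natural numbers by Newton's forward difference formula,
  hence everywhere. For (c), \<open>x\<^bsup>M\<^esup>\<close> and the rate function of the asserted \<open>\<Delta>\<close>-index are given by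
  binomial coefficients of \<open>log x\<close>, so that the claims are restatements of (b).
\<close>

section \<open>Polynomial identities from natural arguments, and Newton's forward difference
  formula\<close>

text \<open>A polynomial with a nonzero coefficient has finitely many roots, but the natural numbers
  are infinitely many.\<close>

lemma real_polynomial_function_eq_0_if_nat:
  fixes p :: "real \<Rightarrow> real"
  assumes "real_polynomial_function p" "\<And>m::nat. p (real m) = 0"
  shows "p x = 0"
proof -
  obtain a N where p: "p = (\<lambda>x. \<Sum>i\<le>N. a i * x ^ i)"
    using assms(1) by (auto simp: real_polynomial_function_iff_sum)
  have "range real \<subseteq> {z. (\<Sum>i\<le>N. a i * z ^ i) = 0}"
    using assms(2) p by auto
  moreover have "infinite (range real)"
    using finite_imageD[of real UNIV] by (auto simp: inj_of_nat)
  ultimately have "infinite {z. (\<Sum>i\<le>N. a i * z ^ i) = 0}"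
    using finite_subset by blast
  then have "\<forall>i\<le>N. a i = 0"
    using polyfun_finite_roots[where c = a and n = N] by blast
  then show ?thesis
    by (simp add: p)
qed

lemma real_polynomial_function_gbinomial: "real_polynomial_function (\<lambda>x. x gchoose k)"
  using real_polynomial_function_gchoose[of k] by (metis ext)

text \<open>Multiplying the argument by e is the operator I + \<Delta>, so multiplying it by its
  \<open>m\<close>-th power expands by the binomial theorem. The induction peels off one factor I +
  \<Delta>, which raises \<open>i\<close>.\<close>

lemma Diff_exp_nat: "Diff i F (exp (real m) * t) = (\<Sum>k\<le>m. real (m choose k) * Diff (i + k) F t)"
proof (induction m arbitrary: i)
  case (Suc m)
  have "Diff i F (exp (real (Suc m)) * t) = Diff (Suc i) F (exp (real m) * t) + Diff i F (exp (real m) * t)"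
    by (simp add: exp_add mult.assoc mult.commute mult.left_commute)
  also have "\<dots> = (\<Sum>k\<le>m. real (m choose k) * Diff (Suc i + k) F t) + (\<Sum>k\<le>m. real (m choose k) * Diff (i + k) F t)"
    by (simp only: Suc)
  \<comment> \<open>The added term has coefficient \<open>m choose Suc m\<close>, which is 0; now
    both sums can be merged by Pascal's rule.\<close>
  also have "(\<Sum>k\<le>m. real (m choose k) * Diff (i + k) F t) = (\<Sum>k\<le>Suc m. real (m choose k) * Diff (i + k) F t)"
    by simp
  finally show ?case
    by (simp only: sum.atMost_Suc_shift[of _ m])
      (simp add: algebra_simps sum.distrib del: Diff.simps)
qed simp

section \<open>Expansions along a regularly varying scale\<close>

text \<open>\<open>\<gamma> 0, \<dots>, \<gamma> (n - 1)\<close> are the components of the rate vector and \<open>E i j (ln x)\<close> is the entry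
  \<open>(i, j)\<close> of \<open>x\<^bsup>B\<^esup>\<close>.\<close>

locale regular_scale =
  fixes n :: nat and \<gamma> :: "nat \<Rightarrow> real \<Rightarrow> real" and E :: "nat \<Rightarrow> nat \<Rightarrow> real \<Rightarrow> real"
  assumes n_pos: "0 < n"
    and nonzero: "i < n \<Longrightarrow> \<forall>\<^sub>F t in at_top. \<gamma> i t \<noteq> 0"
    and Suc_small: "Suc i < n \<Longrightarrow> \<gamma> (Suc i) \<in> o[at_top](\<gamma> i)"
    and E_poly: "real_polynomial_function (E i j)"
    and E_lower: "j < i \<Longrightarrow> i < n \<Longrightarrow> E i j L = 0"
    and E_diag: "i < n \<Longrightarrow> E i i L = 1"
    and scale: "i < n \<Longrightarrow> x > 0 \<Longrightarrow>
      (\<lambda>t. \<gamma> i (x * t) - (\<Sum>j<n. E i j (ln x) * \<gamma> j t)) \<in> o[at_top](\<gamma> (n - 1))"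
begin

text \<open>Coordinates of \<open>F\<close> modulo functions negligible against the last component.
  Only the values of \<open>q\<close> below \<open>n\<close> matter, and \<open>F\<close> determines
  them (\<open>has_coeffs_unique\<close>).\<close>

definition has_coeffs :: "(real \<Rightarrow> real) \<Rightarrow> (nat \<Rightarrow> real) \<Rightarrow> bool" where
  "has_coeffs F q \<longleftrightarrow> (\<lambda>t. F t - (\<Sum>j<n. q j * \<gamma> j t)) \<in> o[at_top](\<gamma> (n - 1))"

lemma small_if_less: "i < j \<Longrightarrow> j < n \<Longrightarrow> \<gamma> j \<in> o[at_top](\<gamma> i)"
proof (induction j)
  case (Suc j)
  then show ?case
    using Suc_small[of j] by (cases "i = j") (auto intro: landau_o.small.trans)
qed simp

lemma last_bigo: "i < n \<Longrightarrow> \<gamma> (n - 1) \<in> O[at_top](\<gamma> i)"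
  using small_if_less[of i "n - 1"] by (cases "i = n - 1") (auto intro: landau_o.small_imp_big)

lemma negligible_imp_small: "i < n \<Longrightarrow> F \<in> o[at_top](\<gamma> (n - 1)) \<Longrightarrow> F \<in> o[at_top](\<gamma> i)"
  using last_bigo landau_o.small_big_trans by blast

lemma has_coeffs_0_iff: "has_coeffs F (\<lambda>_. 0) \<longleftrightarrow> F \<in> o[at_top](\<gamma> (n - 1))"
  by (simp add: has_coeffs_def)

lemma has_coeffs_cong: "(\<And>j. j < n \<Longrightarrow> q j = q' j) \<Longrightarrow> has_coeffs F q \<Longrightarrow> has_coeffs F q'"
  by (simp add: has_coeffs_def)

lemma has_coeffs_scale: "i < n \<Longrightarrow> x > 0 \<Longrightarrow> has_coeffs (\<lambda>t. \<gamma> i (x * t)) (\<lambda>j. E i j (ln x))"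
  using scale by (simp add: has_coeffs_def)

lemma has_coeffs_add:
  assumes "has_coeffs F q" "has_coeffs F' q'"
  shows "has_coeffs (\<lambda>t. F t + F' t) (\<lambda>j. q j + q' j)"
  using sum_in_smallo(1)[OF assms[unfolded has_coeffs_def]]
  by (simp add: has_coeffs_def algebra_simps sum.distrib)

lemma has_coeffs_cmult:
  assumes "has_coeffs F q"
  shows "has_coeffs (\<lambda>t. a * F t) (\<lambda>j. a * q j)"
proof (cases "a = 0")
  case False
  then have "(\<lambda>t. a * (F t - (\<Sum>j<n. q j * \<gamma> j t))) \<in> o[at_top](\<gamma> (n - 1))"
    using assms by (simp add: has_coeffs_def)
  then show ?thesis
    by (simp add: has_coeffs_def algebra_simps sum_distrib_left)
qed (simp add: has_coeffs_def)

lemma has_coeffs_diff: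
  assumes "has_coeffs F q" "has_coeffs F' q'"
  shows "has_coeffs (\<lambda>t. F t - F' t) (\<lambda>j. q j - q' j)"
  using has_coeffs_add[OF assms(1) has_coeffs_cmult[OF assms(2), of "-1"]] by simp

lemma has_coeffs_sum:
  assumes "\<And>k. k \<in> A \<Longrightarrow> has_coeffs (F k) (q k)"
  shows "has_coeffs (\<lambda>t. \<Sum>k\<in>A. a k * F k t) (\<lambda>j. \<Sum>k\<in>A. a k * q k j)"
  using assms
proof (induction A rule: infinite_finite_induct)
  case (insert k A)
  then show ?case
    using has_coeffs_add[OF has_coeffs_cmult[of "F k" "q k" "a k"]] by simp
qed (simp_all add: has_coeffs_def)

text \<open>Terms beyond \<open>i\<close> are of smaller order than \<open>\<gamma> i\<close>, and
  so is the error, since \<open>\<gamma> (n - 1)\<close> is O(\<open>\<gamma> i\<close>).\<close>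

lemma has_coeffs_leading:
  assumes F: "has_coeffs F q" and "i < n" and "\<And>j. j < i \<Longrightarrow> q j = 0"
  shows "(\<lambda>t. F t - q i * \<gamma> i t) \<in> o[at_top](\<gamma> i)"
proof -
  have "(\<lambda>t. q j * \<gamma> j t) \<in> o[at_top](\<gamma> i)" if "j \<in> {..<n} - {i}" for j
  proof (cases "j < i")
    case True
    then show ?thesis
      using assms(3) by simp
  next
    case False
    then show ?thesis
      using small_if_less[of i j] that by (cases "q j = 0") auto
  qed
  then have "(\<lambda>t. \<Sum>j\<in>{..<n} - {i}. q j * \<gamma> j t) \<in> o[at_top](\<gamma> i)"
    by (rule big_sum_in_smallo)
  moreover have "(\<lambda>t. F t - (\<Sum>j<n. q j * \<gamma> j t)) \<in> o[at_top](\<gamma> i)"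
    using F assms(2) negligible_imp_small unfolding has_coeffs_def by blast
  ultimately have "(\<lambda>t. F t - (\<Sum>j<n. q j * \<gamma> j t) + (\<Sum>j\<in>{..<n} - {i}. q j * \<gamma> j t)) \<in> o[at_top](\<gamma> i)"
    by (rule sum_in_smallo(1)[rotated])
  then show ?thesis
    using assms(2) by (simp add: sum.remove[of "{..<n}" i] algebra_simps)
qed

lemma has_coeffs_asymp_equiv:
  assumes "has_coeffs F q" "i < n" "\<And>j. j < i \<Longrightarrow> q j = 0" "q i \<noteq> 0"
  shows "F \<sim>[at_top] (\<lambda>t. q i * \<gamma> i t)"
  using has_coeffs_leading[OF assms(1-3)] assms(4) by (intro smallo_imp_asymp_equiv) simp

text \<open>Linear independence of the components, by comparing orders from the largest down: once
  the earlier coefficients vanish, \<open>q i * \<gamma> i t\<close> is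
  o(\<open>\<gamma> i\<close>).\<close>

lemma has_coeffs_negligible_imp_0:
  assumes F: "has_coeffs F q" and "F \<in> o[at_top](\<gamma> (n - 1))"
  shows "i < n \<Longrightarrow> q i = 0"
proof (induction i rule: less_induct)
  case (less i)
  have "(\<lambda>t. F t - q i * \<gamma> i t) \<in> o[at_top](\<gamma> i)"
    using less by (intro has_coeffs_leading[OF F]) auto
  from sum_in_smallo(2)[OF negligible_imp_small[OF less.prems assms(2)] this]
  have "(\<lambda>t. q i * \<gamma> i t) \<in> o[at_top](\<gamma> i)"
    by simp
  \<comment> \<open>A function that is little-o of itself is eventually zero.\<close>
  then have "\<forall>\<^sub>F t in at_top. \<gamma> i t = 0" if "q i \<noteq> 0"
    using that by (simp add: landau_o.small_refl_iff)
  with nonzero[OF less.prems] show ?case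
    using eventually_happens'[OF trivial_limit_at_top_linorder eventually_conj] by blast
qed

lemma has_coeffs_unique:
  assumes "has_coeffs F q" "has_coeffs F q'" "j < n"
  shows "q j = q' j"
  using has_coeffs_negligible_imp_0[OF has_coeffs_diff[OF assms(1,2)] _ assms(3)] by simp

text \<open>The last row of \<open>E\<close> is a unit vector, so \<open>\<gamma> (n - 1)\<close>
  changes only by a negligible amount under rescaling.\<close>

lemma negligible_rescale:
  assumes "F \<in> o[at_top](\<gamma> (n - 1))" "x > 0"
  shows "(\<lambda>t. F (x * t)) \<in> o[at_top](\<gamma> (n - 1))"
proof -
  have lim: "filterlim (\<lambda>t. x * t) at_top at_top"
    using assms(2) by (intro filterlim_tendsto_pos_mult_at_top[OF tendsto_const] filterlim_ident)
  have "(\<lambda>t. F (x * t)) \<in> o[at_top](\<lambda>t. \<gamma> (n - 1) (x * t))"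
    using landau_o.small.compose[OF assms(1) lim] by simp
  moreover have "(\<lambda>t. \<gamma> (n - 1) (x * t) - 1 * \<gamma> (n - 1) t) \<in> o[at_top](\<gamma> (n - 1))"
    using has_coeffs_leading[OF has_coeffs_scale[of "n - 1"], of x "n - 1"] n_pos assms(2)
    by (simp add: E_diag E_lower)
  then have "(\<lambda>t. \<gamma> (n - 1) (x * t)) \<in> O[at_top](\<gamma> (n - 1))"
    using sum_in_bigo(1)[OF landau_o.small_imp_big landau_o.big_refl, of _ _ "\<gamma> (n - 1)"] by force
  ultimately show ?thesis
    by (rule landau_o.small_big_trans)
qed

text \<open>On coefficient rows, rescaling the argument by \<open>x\<close> acts as right
  multiplication by the matrix \<open>E\<close> at \<open>ln x\<close>.\<close>

lemma has_coeffs_rescale: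
  assumes F: "has_coeffs F q" and x: "x > 0"
  shows "has_coeffs (\<lambda>t. F (x * t)) (\<lambda>j. \<Sum>k<n. q k * E k j (ln x))"
proof -
  have "has_coeffs (\<lambda>t. F (x * t) - (\<Sum>k<n. q k * \<gamma> k (x * t))) (\<lambda>_. 0)"
    using negligible_rescale[OF F[unfolded has_coeffs_def] x] by (simp add: has_coeffs_0_iff)
  moreover have "has_coeffs (\<lambda>t. \<Sum>k<n. q k * \<gamma> k (x * t)) (\<lambda>j. \<Sum>k<n. q k * E k j (ln x))"
    using x by (intro has_coeffs_sum has_coeffs_scale) auto
  ultimately show ?thesis
    using has_coeffs_add[of "\<lambda>t. F (x * t) - (\<Sum>k<n. q k * \<gamma> k (x * t))" "\<lambda>_. 0"] by force
qed

end

section \<open>Iterated differences\<close>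

text \<open>\<open>H j (ln x)\<close> is the component \<open>j\<close> of \<open>c \<integral>\<^sub>1\<^sup>x y\<^bsup>B\<^esup> dy/y\<close>.\<close>

locale Pi_function = regular_scale +
  fixes f :: "real \<Rightarrow> real" and H :: "nat \<Rightarrow> real \<Rightarrow> real"
  assumes H_poly: "real_polynomial_function (H j)"
    and increment: "x > 0 \<Longrightarrow> has_coeffs (\<lambda>t. f (x * t) - f t) (\<lambda>j. H j (ln x))"
begin

text \<open>Row \<open>i\<close> belongs to the difference of order \<open>i + 1\<close>, so these
  are the entries of Q. Each further difference multiplies the row by exp(B) - I, as ln e =
  1.\<close>

primrec dcoeff :: "nat \<Rightarrow> nat \<Rightarrow> real" where
  "dcoeff 0 j = H j 1"
| "dcoeff (Suc i) j = (\<Sum>k<n. dcoeff i k * E k j 1) - dcoeff i j"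

lemma has_coeffs_Diff: "has_coeffs (Diff (Suc i) f) (dcoeff i)"
proof (induction i)
  case 0
  then show ?case
    using increment[of "exp 1"] by (simp add: fun_eq_iff)
next
  case (Suc i)
  show ?case
    using has_coeffs_diff[OF has_coeffs_rescale[OF Suc, of "exp 1"] Suc] by (simp add: fun_eq_iff)
qed

text \<open>\<open>E\<close> at 1 is unitriangular; subtracting the identity leaves a strictly upper
  triangular matrix, so every difference moves the leading index up by at least one.\<close>

lemma dcoeff_lower: "j < i \<Longrightarrow> j < n \<Longrightarrow> dcoeff i j = 0"
proof (induction i arbitrary: j)
  case (Suc i)
  have "dcoeff i k * E k j 1 = 0" if "k < n" "k \<noteq> j" for k
    using that Suc E_lower[of j k] by (cases "k < i") auto
  then have "(\<Sum>k<n. dcoeff i k * E k j 1) = dcoeff i j * E j j 1"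
    using Suc.prems by (subst sum.mono_neutral_right[of "{..<n}" "{j}"]) auto
  then show ?case
    using Suc.prems by (simp add: E_diag)
qed simp

text \<open>Only \<open>k = i\<close> and \<open>k = Suc i\<close> contribute to the new diagonal
  entry, and the latter contribution cancels against the subtracted
  \<open>dcoeff i (Suc i)\<close>.\<close>

lemma dcoeff_diag: "i < n \<Longrightarrow> dcoeff i i = H 0 1 * (\<Prod>k<i. E k (Suc k) 1)"
proof (induction i)
  case (Suc i)
  have "dcoeff i k * E k (Suc i) 1 = 0" if "k < n" "k \<noteq> i" "k \<noteq> Suc i" for k
    using that Suc.prems E_lower[of "Suc i" k] dcoeff_lower[of k i] by (cases "k < i") auto
  then have "(\<Sum>k<n. dcoeff i k * E k (Suc i) 1) = (\<Sum>k\<in>{i, Suc i}. dcoeff i k * E k (Suc i) 1)"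
    using Suc.prems by (intro sum.mono_neutral_right) auto
  then show ?case
    using Suc by (simp add: E_diag)
qed simp

text \<open>Here row \<open>i - 1\<close> of \<open>dcoeff\<close> has index at least
  \<open>n\<close>, so all its entries below \<open>n\<close> vanish.\<close>

lemma negligible_Diff: "n < i \<Longrightarrow> Diff i f \<in> o[at_top](\<gamma> (n - 1))"
  using has_coeffs_cong[OF dcoeff_lower has_coeffs_Diff, of "i - 1"] has_coeffs_0_iff by simp

text \<open>Newton's formula is exact; truncating it drops only differences of order above
  \<open>n\<close>, which are negligible.\<close>

lemma Diff_exp_nat_expansion:
  assumes "i \<le> n"
  shows "(\<lambda>t. Diff i f (exp (real m) * t) - (\<Sum>j=i..n. (real m gchoose (j - i)) * Diff j f t))
    \<in> o[at_top](\<gamma> (n - 1))"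
proof -
  \<comment> \<open>Long enough to contain both the full Newton sum and the truncated one; the
    binomial coefficients beyond \<open>m\<close> are 0.\<close>
  define N where "N = max m (n - i)"
  have "Diff i f (exp (real m) * t) - (\<Sum>j=i..n. (real m gchoose (j - i)) * Diff j f t) =
      (\<Sum>k\<in>{n - i<..N}. real (m choose k) * Diff (i + k) f t)" for t
  proof -
    have "Diff i f (exp (real m) * t) = (\<Sum>k\<le>N. real (m choose k) * Diff (i + k) f t)"
      unfolding Diff_exp_nat by (intro sum.mono_neutral_left) (auto simp: N_def)
    also have "{..N} = {..n - i} \<union> {n - i<..N}"
      by (auto simp: N_def)
    also have "(\<Sum>k\<in>{..n - i} \<union> {n - i<..N}. real (m choose k) * Diff (i + k) f t) =
        (\<Sum>k\<le>n - i. real (m choose k) * Diff (i + k) f t) + (\<Sum>k\<in>{n - i<..N}. real (m choose k) * Diff (i + k) f t)"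
      by (rule sum.union_disjoint) auto
    also have "(\<Sum>k\<le>n - i. real (m choose k) * Diff (i + k) f t) = (\<Sum>j=i..n. (real m gchoose (j - i)) * Diff j f t)"
      by (rule sum.reindex_bij_witness[of _ "\<lambda>j. j - i" "\<lambda>k. i + k"])
        (use assms in \<open>auto simp: binomial_gbinomial\<close>)
    finally show ?thesis
      by simp
  qed
  moreover have "(\<lambda>t. \<Sum>k\<in>{n - i<..N}. real (m choose k) * Diff (i + k) f t) \<in> o[at_top](\<gamma> (n - 1))"
  proof (rule big_sum_in_smallo)
    fix k assume "k \<in> {n - i<..N}"
    then have "Diff (i + k) f \<in> o[at_top](\<gamma> (n - 1))"
      by (intro negligible_Diff) auto
    then show "(\<lambda>t. real (m choose k) * Diff (i + k) f t) \<in> o[at_top](\<gamma> (n - 1))"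
      by (cases "real (m choose k) = 0") auto
  qed
  ultimately show ?thesis
    by simp
qed

text \<open>Phrased for increments because this covers \<open>i = 0\<close>: the hypotheses give
  coefficients for increments of \<open>f\<close>, not for \<open>f\<close> itself.\<close>

lemma Diff_increment_poly:
  "\<exists>W. (\<forall>j. real_polynomial_function (W j)) \<and>
    (\<forall>x>0. has_coeffs (\<lambda>t. Diff i f (x * t) - Diff i f t) (\<lambda>j. W j (ln x)))"
proof (cases i)
  case 0
  then show ?thesis
    using H_poly increment by (intro exI[of _ H]) simp
next
  case (Suc i')
  have "\<forall>x>0. has_coeffs (\<lambda>t. Diff i f (x * t) - Diff i f t)
      (\<lambda>j. (\<Sum>k<n. dcoeff i' k * E k j (ln x)) - dcoeff i' j)"
    unfolding Suc by (intro allI impI has_coeffs_diff has_coeffs_rescale has_coeffs_Diff)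
  moreover have "real_polynomial_function (\<lambda>L. (\<Sum>k<n. dcoeff i' k * E k j L) - dcoeff i' j)" for j
    by (intro real_polynomial_function_diff real_polynomial_function_sum real_polynomial_function.intros E_poly) auto
  ultimately show ?thesis
    by (intro exI[of _ "\<lambda>j L. (\<Sum>k<n. dcoeff i' k * E k j L) - dcoeff i' j"]) simp
qed

text \<open>The coefficients of the error term are polynomials in \<open>ln x\<close>, and they vanish when \<open>ln x\<close> is a
  natural number by Newton's forward difference formula.\<close>

theorem Diff_expansion_binomial:
  assumes "i \<le> n" "x > 0"
  shows "(\<lambda>t. Diff i f (x * t) - (\<Sum>j=i..n. (ln x gchoose (j - i)) * Diff j f t))
    \<in> o[at_top](\<gamma> (n - 1))" (is "?R x \<in> _")
proof -
  obtain W where W: "\<And>j. real_polynomial_function (W j)"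
    "\<And>x. x > 0 \<Longrightarrow> has_coeffs (\<lambda>t. Diff i f (x * t) - Diff i f t) (\<lambda>j. W j (ln x))"
    using Diff_increment_poly by blast
  \<comment> \<open>Coefficients of the error. The summand \<open>j = i\<close> is
    \<open>Diff i f t\<close> itself and is absorbed into the increment; the remaining orders are at
    least 1, so \<open>dcoeff (j - 1)\<close> applies.\<close>
  define V where "V l L = W l L - (\<Sum>j=Suc i..n. (L gchoose (j - i)) * dcoeff (j - 1) l)" for l L
  have V: "has_coeffs (?R y) (\<lambda>l. V l (ln y))" if "y > 0" for y
  proof -
    have "has_coeffs (\<lambda>t. \<Sum>j=Suc i..n. (ln y gchoose (j - i)) * Diff j f t)
        (\<lambda>l. \<Sum>j=Suc i..n. (ln y gchoose (j - i)) * dcoeff (j - 1) l)"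
    proof (rule has_coeffs_sum)
      fix j assume "j \<in> {Suc i..n}"
      then show "has_coeffs (Diff j f) (dcoeff (j - 1))"
        using has_coeffs_Diff[of "j - 1"] by simp
    qed
    from has_coeffs_diff[OF W(2)[OF that] this] show ?thesis
      using assms(1) by (simp add: V_def sum.atLeast_Suc_atMost[of i n] algebra_simps)
  qed
  have "V l (ln x) = 0" if "l < n" for l
  proof (rule real_polynomial_function_eq_0_if_nat[where p = "V l"])
    show "real_polynomial_function (V l)"
      unfolding V_def
      by (intro real_polynomial_function_diff W(1) real_polynomial_function_sum
          real_polynomial_function.intros real_polynomial_function_gbinomial) auto
    show "V l (real m) = 0" for m
      using has_coeffs_negligible_imp_0[OF V[of "exp (real m)"] _ that] Diff_exp_nat_expansion[OF assms(1), of m]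
      by simp
  qed
  then show ?thesis
    using has_coeffs_cong[OF _ V[OF assms(2)], of "\<lambda>_. 0"] has_coeffs_0_iff by simp
qed

section \<open>Sign and order of magnitude of the differences when the diagonal coefficients are
  nonzero\<close>

lemma Diff_asymp_equiv:
  "i < n \<Longrightarrow> dcoeff i i \<noteq> 0 \<Longrightarrow> Diff (Suc i) f \<sim>[at_top] (\<lambda>t. dcoeff i i * \<gamma> i t)"
  using dcoeff_lower by (intro has_coeffs_asymp_equiv has_coeffs_Diff) auto

lemma Diff_bigtheta:
  assumes "i < n" "dcoeff i i \<noteq> 0"
  shows "Diff (Suc i) f \<in> \<Theta>[at_top](\<gamma> i)"
  using asymp_equiv_imp_bigtheta[OF Diff_asymp_equiv[OF assms]] assms(2) by simp

lemma Diff_constant_sign: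
  assumes "i < n" "dcoeff i i \<noteq> 0" "eventually_constant_sign (\<gamma> i)"
  shows "eventually_constant_sign (Diff (Suc i) f)"
proof -
  have sgn: "\<forall>\<^sub>F t in at_top. sgn (Diff (Suc i) f t) = sgn (dcoeff i i) * sgn (\<gamma> i t)"
    using asymp_equiv_imp_eventually_same_sign[OF Diff_asymp_equiv[OF assms(1,2)]]
    by (simp add: sgn_mult)
  have "(\<forall>\<^sub>F t in at_top. sgn (\<gamma> i t) = 1) \<or> (\<forall>\<^sub>F t in at_top. sgn (\<gamma> i t) = -1)"
    using assms(3) by (simp add: eventually_constant_sign_def sgn_1_pos sgn_1_neg)
  then obtain s :: real where s: "s = 1 \<or> s = -1" "\<forall>\<^sub>F t in at_top. sgn (\<gamma> i t) = s"
    by blast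
  have "\<forall>\<^sub>F t in at_top. sgn (Diff (Suc i) f t) = sgn (dcoeff i i) * s"
    using sgn s(2) by eventually_elim (simp del: Diff.simps)
  moreover have "sgn (dcoeff i i) * s = 1 \<or> sgn (dcoeff i i) * s = -1"
    using assms(2) s(1) by (auto simp: sgn_if)
  ultimately show ?thesis
    unfolding eventually_constant_sign_def sgn_1_pos[symmetric] sgn_1_neg[symmetric] by metis
qed

lemma Diff_Suc_small:
  assumes "Suc i < n" "dcoeff i i \<noteq> 0" "dcoeff (Suc i) (Suc i) \<noteq> 0"
  shows "Diff (Suc (Suc i)) f \<in> o[at_top](Diff (Suc i) f)"
proof -
  have "Diff (Suc (Suc i)) f \<in> O[at_top](\<gamma> (Suc i))"
    using Diff_bigtheta[OF assms(1,3)] by (rule bigthetaD1)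
  also have "\<gamma> (Suc i) \<in> o[at_top](\<gamma> i)"
    using assms(1) by (rule Suc_small)
  also have "\<gamma> i \<in> O[at_top](Diff (Suc i) f)"
    using Diff_bigtheta[of i] assms by (intro bigthetaD1[OF bigtheta_sym[THEN iffD1]]) simp
  finally show ?thesis .
qed

text \<open>The last difference has the same order as the last component of the scale. Errors can
  thus be measured against the differences themselves, as (c) requires.\<close>

lemma negligible_imp_small_Diff:
  assumes "dcoeff (n - 1) (n - 1) \<noteq> 0" "F \<in> o[at_top](\<gamma> (n - 1))"
  shows "F \<in> o[at_top](Diff n f)"
proof -
  have "\<gamma> (n - 1) \<in> O[at_top](Diff n f)"
    using Diff_bigtheta[of "n - 1"] assms n_pos by (intro bigthetaD1[OF bigtheta_sym[THEN iffD1]]) simp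
  then show ?thesis
    using assms(2) landau_o.small_big_trans by blast
qed

end

section \<open>Entries of matrix products, and invertibility of triangular matrices\<close>

lemma mult_mat_vec_nth:
  "A \<in> carrier_mat n n \<Longrightarrow> v \<in> carrier_vec n \<Longrightarrow> i < n \<Longrightarrow> (A *\<^sub>v v) $ i = (\<Sum>j<n. A $$ (i, j) * v $ j)"
  by (auto simp: scalar_prod_def lessThan_atLeast0)

lemma mult_mat_nth:
  "A \<in> carrier_mat n n \<Longrightarrow> B \<in> carrier_mat n n \<Longrightarrow> i < n \<Longrightarrow> j < n \<Longrightarrow>
    (A * B) $$ (i, j) = (\<Sum>l<n. A $$ (i, l) * B $$ (l, j))"
  by (auto simp: scalar_prod_def lessThan_atLeast0)

lemma smult_pow_mat:
  fixes B :: "'a :: comm_semiring_1 mat"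
  assumes "B \<in> carrier_mat n n"
  shows "(a \<cdot>\<^sub>m B) ^\<^sub>m k = a ^ k \<cdot>\<^sub>m (B ^\<^sub>m k)"
proof (induction k)
  case 0
  then show ?case
    using assms by (intro eq_matI) auto
next
  case (Suc k)
  have "(a ^ k \<cdot>\<^sub>m (B ^\<^sub>m k)) * (a \<cdot>\<^sub>m B) = a ^ Suc k \<cdot>\<^sub>m (B ^\<^sub>m k * B)"
  proof (rule eq_matI)
    fix i j assume "i < dim_row (a ^ Suc k \<cdot>\<^sub>m (B ^\<^sub>m k * B))" "j < dim_col (a ^ Suc k \<cdot>\<^sub>m (B ^\<^sub>m k * B))"
    then have "i < n" "j < n"
      using assms by auto
    moreover have "B ^\<^sub>m k \<in> carrier_mat n n"
      using assms by simp
    ultimately show "((a ^ k \<cdot>\<^sub>m (B ^\<^sub>m k)) * (a \<cdot>\<^sub>m B)) $$ (i, j) = (a ^ Suc k \<cdot>\<^sub>m (B ^\<^sub>m k * B)) $$ (i, j)"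
      using assms by (simp add: mult_mat_nth[of _ n] sum_distrib_left mult_ac del: index_mult_mat(1))
  qed (use assms in auto)
  then show ?case
    using Suc by simp
qed

lemma invertible_mat_iff_det:
  fixes A :: "'a :: field mat"
  assumes A: "A \<in> carrier_mat n n"
  shows "invertible_mat A \<longleftrightarrow> det A \<noteq> 0"
proof
  assume "invertible_mat A"
  then obtain C where C: "A * C = 1\<^sub>m n" "C * A = 1\<^sub>m (dim_row C)"
    using A by (auto simp: invertible_mat_def inverts_mat_def)
  \<comment> \<open>The dimensions of the inverse are not part of \<open>invertible_mat\<close>;
    they are read off the two products.\<close>
  have "C \<in> carrier_mat n n"
    using arg_cong[OF C(1), of dim_col] arg_cong[OF C(2), of dim_col] A by auto
  then show "det A \<noteq> 0"
    using det_mult[OF A, of C] C(1) by auto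
next
  assume "det A \<noteq> 0"
  from det_non_zero_imp_unit[OF A this, of "()"] obtain C where
    "C \<in> carrier_mat n n" "C * A = 1\<^sub>m n" "A * C = 1\<^sub>m n"
    by (auto simp: Units_def ring_mat_def)
  then show "invertible_mat A"
    using A by (auto simp: invertible_mat_def inverts_mat_def)
qed

lemma invertible_upper_triangular_iff:
  fixes A :: "'a :: field mat"
  assumes "A \<in> carrier_mat n n" "upper_triangular A"
  shows "invertible_mat A \<longleftrightarrow> (\<forall>i<n. A $$ (i, i) \<noteq> 0)"
  using assms
  by (auto simp: invertible_mat_iff_det det_upper_triangular prod_list_diag_prod)

section \<open>Powers with a nilpotent exponent\<close>

text \<open>Entry of exp(L B) for nilpotent \<open>B\<close>, where cutting the exponential series
  at \<open>n\<close> is exact.\<close>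

definition exp_entry :: "nat \<Rightarrow> real mat \<Rightarrow> nat \<Rightarrow> nat \<Rightarrow> real \<Rightarrow> real" where
  "exp_entry n B i j L = (\<Sum>k<n. (B ^\<^sub>m k) $$ (i, j) * (L ^ k / fact k))"

text \<open>The antiderivative of \<open>exp_entry\<close> in \<open>L\<close> that vanishes at 0;
  substituting L = ln y turns dy/y into dL.\<close>

definition exp_integral_entry :: "nat \<Rightarrow> real mat \<Rightarrow> nat \<Rightarrow> nat \<Rightarrow> real \<Rightarrow> real" where
  "exp_integral_entry n B i j L = (\<Sum>k<n. (B ^\<^sub>m k) $$ (i, j) * (L ^ Suc k / fact (Suc k)))"

lemma real_polynomial_function_power_divide: "real_polynomial_function (\<lambda>L. L ^ k / c)"
  by (intro real_polynomial_function_divide real_polynomial_function_power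
      real_polynomial_function.intros(1) bounded_linear_ident)

lemma real_polynomial_function_exp_entry: "real_polynomial_function (exp_entry n B i j)"
  unfolding exp_entry_def
  by (intro real_polynomial_function_sum real_polynomial_function.intros(2,4)
      real_polynomial_function_power_divide) auto

lemma real_polynomial_function_exp_integral_entry:
  "real_polynomial_function (exp_integral_entry n B i j)"
  unfolding exp_integral_entry_def
  by (intro real_polynomial_function_sum real_polynomial_function.intros(2,4)
      real_polynomial_function_power_divide) auto

locale strictly_upper_triangular =
  fixes n :: nat and B :: "real mat"
  assumes carrier: "B \<in> carrier_mat n n"
    and strict: "i < n \<Longrightarrow> j \<le> i \<Longrightarrow> B $$ (i, j) = 0"
begin

text \<open>Each factor \<open>B\<close> moves at least one place above the diagonal. In particular
  the powers from \<open>n\<close> on vanish.\<close>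

lemma pow_lower: "i < n \<Longrightarrow> j < n \<Longrightarrow> j < i + k \<Longrightarrow> (B ^\<^sub>m k) $$ (i, j) = 0"
proof (induction k arbitrary: j)
  case 0
  then show ?case
    using carrier by auto
next
  case (Suc k)
  have "(B ^\<^sub>m k) $$ (i, l) * B $$ (l, j) = 0" if "l < n" for l
    using Suc that strict[of l j] by (cases "l < i + k") auto
  then have "(\<Sum>l<n. (B ^\<^sub>m k) $$ (i, l) * B $$ (l, j)) = 0"
    by (intro sum.neutral) blast
  moreover have "B ^\<^sub>m k \<in> carrier_mat n n"
    using carrier by simp
  ultimately show ?case
    using carrier Suc.prems by (simp add: mult_mat_nth[of _ n] del: index_mult_mat(1))
qed

lemma mat_powr_eq:
  assumes "i < n" "j < n"
  shows "mat_powr x B $$ (i, j) = exp_entry n B i j (ln x)"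
proof -
  have "(\<Sum>k. ((ln x \<cdot>\<^sub>m B) ^\<^sub>m k) $$ (i, j) / fact k) = (\<Sum>k. (B ^\<^sub>m k) $$ (i, j) * ((ln x) ^ k / fact k))"
    using assms carrier by (intro suminf_cong) (auto simp: smult_pow_mat[of _ n])
  also have "\<dots> = exp_entry n B i j (ln x)"
    unfolding exp_entry_def using assms by (intro suminf_finite) (auto simp: pow_lower)
  finally show ?thesis
    using assms carrier by (simp add: mat_powr_def mat_exp_def)
qed

lemma exp_entry_lower: "j < i \<Longrightarrow> i < n \<Longrightarrow> exp_entry n B i j L = 0"
  by (auto simp: exp_entry_def pow_lower intro!: sum.neutral)

lemma exp_entry_diag:
  assumes "i < n"
  shows "exp_entry n B i i L = 1"
proof -
  have "exp_entry n B i i L = (\<Sum>k\<in>{0}. (B ^\<^sub>m k) $$ (i, i) * (L ^ k / fact k))"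
    unfolding exp_entry_def using assms by (intro sum.mono_neutral_right) (auto simp: pow_lower)
  then show ?thesis
    using assms carrier by simp
qed

lemma exp_entry_superdiag:
  assumes "Suc i < n"
  shows "exp_entry n B i (Suc i) 1 = B $$ (i, Suc i)"
proof -
  have "exp_entry n B i (Suc i) 1 = (\<Sum>k\<in>{1}. (B ^\<^sub>m k) $$ (i, Suc i) * (1 ^ k / fact k))"
    unfolding exp_entry_def
  proof (intro sum.mono_neutral_right ballI)
    fix k assume "k \<in> {..<n} - {1}"
    then show "(B ^\<^sub>m k) $$ (i, Suc i) * (1 ^ k / fact k) = 0"
      using assms carrier pow_lower[of i "Suc i" k] by (cases k) auto
  qed (use assms in auto)
  then show ?thesis
    using assms carrier by simp
qed

lemma exp_integral_entry_lower: "j < i \<Longrightarrow> i < n \<Longrightarrow> exp_integral_entry n B i j L = 0"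
  by (auto simp: exp_integral_entry_def pow_lower intro!: sum.neutral)

lemma exp_integral_entry_diag:
  assumes "i < n"
  shows "exp_integral_entry n B i i L = L"
proof -
  have "exp_integral_entry n B i i L = (\<Sum>k\<in>{0}. (B ^\<^sub>m k) $$ (i, i) * (L ^ Suc k / fact (Suc k)))"
    unfolding exp_integral_entry_def using assms by (intro sum.mono_neutral_right) (auto simp: pow_lower)
  then show ?thesis
    using assms carrier by simp
qed

lemma int_mat_powr_eq:
  assumes "i < n" "j < n" "x > 0"
  shows "int_mat_powr n B x $$ (i, j) = exp_integral_entry n B i j (ln x)"
proof -
  \<comment> \<open>Whichever side of 1 the point \<open>x\<close> lies on, the integration interval
    stays where \<open>ln\<close> is differentiable.\<close>
  have pos: "0 < y" if "min 1 x \<le> y" for y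
    using that assms(3) by linarith
  have "(LBINT y=ereal 1..ereal x. exp_entry n B i j (ln y) * inverse y) =
      exp_integral_entry n B i j (ln x) - exp_integral_entry n B i j (ln 1)"
  proof (rule interval_integral_FTC_finite)
    show "continuous_on {min 1 x..max 1 x} (\<lambda>y. exp_entry n B i j (ln y) * inverse y)"
      unfolding exp_entry_def using pos by (intro continuous_intros) force+
    fix y assume "min 1 x \<le> y" "y \<le> max 1 x"
    with pos have "0 < y"
      by blast
    have "((\<lambda>y. (B ^\<^sub>m k) $$ (i, j) * (ln y ^ Suc k / fact (Suc k))) has_real_derivative
        (B ^\<^sub>m k) $$ (i, j) * (ln y ^ k / fact k) * inverse y) (at y)" for k
    proof -
      have "((\<lambda>y. ln y ^ Suc k) has_real_derivative real (Suc k) * (inverse y * ln y ^ k)) (at y)"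
        using DERIV_power_Suc[OF DERIV_ln[OF \<open>0 < y\<close>], of k] by (simp add: algebra_simps)
      from DERIV_cmult[OF DERIV_cdivide[OF this, of "fact (Suc k)"], of "(B ^\<^sub>m k) $$ (i, j)"]
      show ?thesis
        by (simp add: algebra_simps del: of_nat_Suc power_Suc)
    qed
    then have "((\<lambda>y. exp_integral_entry n B i j (ln y)) has_real_derivative
        (exp_entry n B i j (ln y) * inverse y)) (at y)"
      unfolding exp_integral_entry_def exp_entry_def sum_distrib_right
      by (intro DERIV_sum)
    then show "((\<lambda>y. exp_integral_entry n B i j (ln y)) has_vector_derivative
        (exp_entry n B i j (ln y) * inverse y)) (at y within {min 1 x..max 1 x})"
      by (simp add: has_real_derivative_iff_has_vector_derivative has_vector_derivative_at_within)
  qed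
  \<comment> \<open>The antiderivative is 0 at \<open>ln 1\<close>, since each of its terms carries
    a positive power of \<open>L\<close>.\<close>
  then show ?thesis
    using assms by (simp add: int_mat_powr_def mat_powr_eq) (simp add: exp_integral_entry_def)
qed

lemma mat_powr_mult_vec_nth:
  assumes "v \<in> carrier_vec n" "i < n"
  shows "(mat_powr x B *\<^sub>v v) $ i = (\<Sum>j<n. exp_entry n B i j (ln x) * v $ j)"
proof -
  have "mat_powr x B \<in> carrier_mat n n"
    using carrier by (simp add: mat_powr_def mat_exp_def)
  then show ?thesis
    using assms by (simp add: mult_mat_vec_nth[of _ n] mat_powr_eq del: index_mult_mat_vec)
qed

lemma Pi_rate_scalar_prod:
  assumes "c \<in> carrier_vec n" "v \<in> carrier_vec n" "x > 0"
  shows "Pi_rate n B c x \<bullet> v = (\<Sum>j<n. (\<Sum>i<n. c $ i * exp_integral_entry n B i j (ln x)) * v $ j)"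
proof -
  have carr: "transpose_mat (int_mat_powr n B x) \<in> carrier_mat n n"
    by (simp add: int_mat_powr_def)
  have "Pi_rate n B c x $ j = (\<Sum>i<n. c $ i * exp_integral_entry n B i j (ln x))" if "j < n" for j
  proof -
    have "transpose_mat (int_mat_powr n B x) $$ (j, i) = exp_integral_entry n B i j (ln x)" if "i < n" for i
      using int_mat_powr_eq[of i j x] \<open>i < n\<close> \<open>j < n\<close> assms(3) by (simp add: int_mat_powr_def)
    then show ?thesis
      unfolding Pi_rate_def using carr assms(1) that
      by (simp add: mult_mat_vec_nth[of _ n] mult.commute del: index_mult_mat_vec)
  qed
  then show ?thesis
    using assms(2) by (simp add: scalar_prod_def lessThan_atLeast0)
qed

end

section \<open>The index matrix of the differences\<close>

text \<open>The power series \<open>a\<close> evaluated at the nilpotent shift; matrix products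
  become products of formal power series.\<close>

definition toeplitz :: "nat \<Rightarrow> 'a :: comm_ring_1 fps \<Rightarrow> 'a mat" where
  "toeplitz n a = mat n n (\<lambda>(i, j). if i \<le> j then fps_nth a (j - i) else 0)"

lemma toeplitz_nth:
  "i < n \<Longrightarrow> j < n \<Longrightarrow> toeplitz n a $$ (i, j) = (if i \<le> j then fps_nth a (j - i) else 0)"
  by (simp add: toeplitz_def)

text \<open>Only \<open>l\<close> between \<open>i\<close> and \<open>j\<close> contributes, and the
  shift \<open>m = l - i\<close> gives the Cauchy product at \<open>j - i\<close>.\<close>

lemma toeplitz_mult: "toeplitz n a * toeplitz n b = toeplitz n (a * b)"
proof (rule eq_matI)
  fix i j assume "i < dim_row (toeplitz n (a * b))" "j < dim_col (toeplitz n (a * b))"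
  then have ij: "i < n" "j < n"
    by (auto simp: toeplitz_def)
  have "(toeplitz n a * toeplitz n b) $$ (i, j) =
      (\<Sum>l<n. toeplitz n a $$ (i, l) * toeplitz n b $$ (l, j))"
    by (rule mult_mat_nth) (use ij in \<open>auto simp: toeplitz_def\<close>)
  also have "\<dots> = (\<Sum>l\<in>{i..j}. fps_nth a (l - i) * fps_nth b (j - l))"
    using ij by (intro sum.mono_neutral_cong_right) (auto simp: toeplitz_def)
  also have "\<dots> = toeplitz n (a * b) $$ (i, j)"
  proof (cases "i \<le> j")
    case True
    have "(\<Sum>l\<in>{i..j}. fps_nth a (l - i) * fps_nth b (j - l)) =
        (\<Sum>m=0..j - i. fps_nth a m * fps_nth b (j - i - m))"
      by (rule sum.reindex_bij_witness[of _ "\<lambda>m. m + i" "\<lambda>l. l - i"]) (use True in auto)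
    then show ?thesis
      using True ij by (simp add: toeplitz_def fps_mult_nth)
  qed (use ij in \<open>simp add: toeplitz_def\<close>)
  finally show "(toeplitz n a * toeplitz n b) $$ (i, j) = toeplitz n (a * b) $$ (i, j)" .
qed (auto simp: toeplitz_def)

lemma toeplitz_pow: "toeplitz n a ^\<^sub>m k = toeplitz n (a ^ k)"
proof (induction k)
  case 0
  show ?case
    by (rule eq_matI) (auto simp: toeplitz_def)
next
  case (Suc k)
  then show ?case
    by (simp add: toeplitz_mult mult.commute)
qed

text \<open>With the nilpotent shift \<open>N\<close>, \<open>M = log (I + N)\<close>, so that \<open>x\<^bsup>M\<^esup> = (I + N)\<^bsup>log x\<^esup>\<close> has binomial entries.\<close>

lemma Diff_index_mat_eq_toeplitz: "Diff_index_mat n = toeplitz n (fps_ln 1)"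
  by (rule eq_matI) (auto simp: Diff_index_mat_def toeplitz_def fps_ln_nth)

text \<open>Both series solve (1 + X) y' = L y with constant term 1, which characterizes the
  binomial series.\<close>

lemma fps_exp_compose_ln: "fps_exp L oo fps_ln 1 = fps_binomial (L :: 'a :: field_char_0)"
proof -
  have "fps_deriv (fps_exp L oo fps_ln 1) = fps_const L * (fps_exp L oo fps_ln 1) / (1 + fps_X)"
    by (simp add: fps_compose_deriv fps_compose_mult_distrib fps_ln_deriv fps_divide_unit)
  then show ?thesis
    by (subst fps_binomial_ODE_unique'[symmetric]) simp
qed

text \<open>The series log(1 + X) has no constant term, so its powers beyond \<open>m\<close> do not
  reach degree \<open>m\<close> and any bound above \<open>m\<close> gives the full
  coefficient.\<close>

lemma sum_fps_ln_power:
  assumes "m < n"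
  shows "(\<Sum>k<n. fps_nth (fps_ln 1 ^ k) m * (L ^ k / fact k)) = (L gchoose m :: real)"
proof -
  have "(\<Sum>k<n. fps_nth (fps_ln 1 ^ k) m * (L ^ k / fact k)) =
      (\<Sum>k=0..m. fps_nth (fps_ln 1 ^ k) m * (L ^ k / fact k))"
    using assms by (intro sum.mono_neutral_right) (auto simp: startsby_zero_power_prefix)
  also have "\<dots> = fps_nth (fps_exp L oo fps_ln 1) m"
    by (simp add: fps_compose_nth mult.commute)
  finally show ?thesis
    by (simp add: fps_exp_compose_ln)
qed

lemma strictly_upper_triangular_Diff_index_mat:
  "strictly_upper_triangular n (Diff_index_mat n)"
  by unfold_locales (auto simp: Diff_index_mat_def)

lemma exp_entry_Diff_index_mat:
  assumes "i < n" "j < n"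
  shows "exp_entry n (Diff_index_mat n) i j L = (if i \<le> j then L gchoose (j - i) else 0)"
  using assms sum_fps_ln_power[of "j - i" n L]
  by (simp add: exp_entry_def Diff_index_mat_eq_toeplitz toeplitz_pow toeplitz_nth)

text \<open>\<open>Diff_index_vec\<close> lists the coefficients of log(1 + X) from degree 1 on.
  Multiplying by the \<open>k\<close>-th power of log(1 + X) yields the next power, one degree
  higher, so the terms of exp(L log(1 + X)) with positive exponent appear.\<close>

lemma exp_integral_entry_Diff_index_mat:
  assumes "j < n"
  shows "(\<Sum>i<n. Diff_index_vec n $ i * exp_integral_entry n (Diff_index_mat n) i j L) =
    L gchoose (Suc j)"
proof -
  have "(\<Sum>i<n. Diff_index_vec n $ i * exp_integral_entry n (Diff_index_mat n) i j L) =
      (\<Sum>i\<le>j. fps_nth (fps_ln 1) (Suc i) *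
        (\<Sum>k<n. fps_nth (fps_ln 1 ^ k) (j - i) * (L ^ Suc k / fact (Suc k))))"
    using assms
    by (intro sum.mono_neutral_cong_right)
      (auto simp: exp_integral_entry_def Diff_index_mat_eq_toeplitz toeplitz_pow toeplitz_nth
        Diff_index_vec_def fps_ln_nth split: if_splits)
  also have "\<dots> = (\<Sum>k<n. (\<Sum>i\<le>j. fps_nth (fps_ln 1) (Suc i) * fps_nth (fps_ln 1 ^ k) (j - i)) *
      (L ^ Suc k / fact (Suc k)))"
    unfolding sum_distrib_left sum_distrib_right by (subst sum.swap) (simp add: mult.assoc)
  also have "\<dots> = (\<Sum>k<n. fps_nth (fps_ln 1 ^ Suc k) (Suc j) * (L ^ Suc k / fact (Suc k)))"
    by (simp add: fps_mult_nth sum.atLeast0_atMost_Suc_shift atMost_atLeast0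
        del: fact_Suc sum.cl_ivl_Suc)
  \<comment> \<open>The new term \<open>k = 0\<close> is the coefficient of the series 1 in degree
    \<open>Suc j\<close>, hence 0.\<close>
  also have "\<dots> = (\<Sum>k<Suc n. fps_nth (fps_ln 1 ^ k) (Suc j) * (L ^ k / fact k))"
    unfolding sum.lessThan_Suc_shift by simp
  finally show ?thesis
    using assms sum_fps_ln_power[of "Suc j" "Suc n" L] by (simp del: sum.lessThan_Suc)
qed

text \<open>0 is the only possible eigenvalue, and the definition exempts the smallest eigenvalue
  from the multiplicity condition.\<close>

lemma index_matrix_strictly_upper_triangular:
  assumes "strictly_upper_triangular n B"
  shows "index_matrix n B"
proof -
  interpret strictly_upper_triangular n B
    by (fact assms)
  have "ev = 0" if "eigenvalue B ev" for ev
  proof -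
    have "upper_triangular B"
      using carrier strict by auto
    moreover have "set (diag_mat B) \<subseteq> {0}"
      using carrier strict by (auto simp: diag_mat_def)
    ultimately show ?thesis
      using that char_poly_upper_triangular[OF carrier] eigenvalue_root_char_poly[OF carrier, of ev]
      by (auto simp: poly_prod_list prod_list_zero_iff)
  qed
  then show ?thesis
    using carrier strict by (auto simp: index_matrix_def)
qed

section \<open>Domains and measurability\<close>

text \<open>Scaling pulls Lebesgue measurable sets back to Lebesgue measurable sets, as composition
  with a merely Lebesgue measurable \<open>f\<close> requires.\<close>

lemma lebesgue_measurable_fun_rescale:
  assumes "lebesgue_measurable_fun D f"
  shows "lebesgue_measurable_fun {t. a * t \<in> D} (\<lambda>t. f (a * t))"
proof -
  have "(*\<^sub>R) a = ((*) a :: real \<Rightarrow> real)"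
    by (rule ext) simp
  then have a: "(*) a \<in> lebesgue \<rightarrow>\<^sub>M (lebesgue :: real measure)"
    using lebesgue_measurable_scaling[of a, where 'a = real] by (simp only:)
  have "(*) a -` D \<inter> space lebesgue \<in> sets lebesgue"
    using assms a by (intro measurable_sets) (auto simp: lebesgue_measurable_fun_def)
  moreover have "(\<lambda>t. f (a * t)) \<in> borel_measurable (lebesgue_on {t. a * t \<in> D})"
    using assms
    by (intro measurable_compose[OF measurable_restrict_space3[OF a, of _ D]])
      (auto simp: lebesgue_measurable_fun_def)
  ultimately show ?thesis
    by (simp add: lebesgue_measurable_fun_def vimage_def)
qed

lemma lebesgue_measurable_fun_subset:
  "lebesgue_measurable_fun D f \<Longrightarrow> D' \<in> sets lebesgue \<Longrightarrow> D' \<subseteq> D \<Longrightarrow> lebesgue_measurable_fun D' f"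
  by (auto simp: lebesgue_measurable_fun_def intro: measurable_restrict_mono)

lemma lebesgue_measurable_fun_Diff:
  assumes "lebesgue_measurable_fun D f"
  shows "lebesgue_measurable_fun (Diff_dom k D) (Diff k f)"
proof (induction k)
  case 0
  then show ?case
    using assms by (simp add: lebesgue_measurable_fun_def)
next
  case (Suc k)
  let ?D = "Diff_dom (Suc k) D"
  note scaled = lebesgue_measurable_fun_rescale[OF Suc, of "exp 1"]
  have D: "?D = {t. exp 1 * t \<in> Diff_dom k D} \<inter> Diff_dom k D"
    by auto
  then have "?D \<in> sets lebesgue"
    using scaled Suc by (auto simp: lebesgue_measurable_fun_def)
  then have "lebesgue_measurable_fun ?D (\<lambda>t. Diff k f (exp 1 * t))" "lebesgue_measurable_fun ?D (Diff k f)"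
    using lebesgue_measurable_fun_subset[OF scaled] lebesgue_measurable_fun_subset[OF Suc] D by auto
  then show ?case
    by (auto simp: lebesgue_measurable_fun_def fun_eq_iff[symmetric])
qed

lemma Diff_dom_antimono: "k \<le> m \<Longrightarrow> Diff_dom m D \<subseteq> Diff_dom k D"
  by (rule lift_Suc_antimono_le[of "\<lambda>k. Diff_dom k D"]) auto

lemma nbhd_of_infinity_Diff_dom:
  assumes "nbhd_of_infinity D"
  shows "nbhd_of_infinity (Diff_dom k D)"
proof -
  obtain t0 where t0: "{t0..} \<subseteq> D"
    using assms by (auto simp: nbhd_of_infinity_def)
  \<comment> \<open>A nonnegative starting point makes the half-line invariant under multiplication
    by e.\<close>
  have "{max 0 t0..} \<subseteq> Diff_dom k D"
  proof (induction k)
    case 0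
    then show ?case
      using t0 by auto
  next
    case (Suc k)
    have "exp 1 * t \<ge> max 0 t0" if "t \<ge> max 0 t0" for t :: real
      using that mult_right_mono[of 1 "exp 1" t] by simp
    then show ?case
      using Suc by auto
  qed
  then show ?thesis
    by (auto simp: nbhd_of_infinity_def)
qed

section \<open>Differences of a function in the class \<open>\<Pi>(g)\<close>\<close>

locale Pi_class_zero_diag =
  fixes n :: nat and B :: "real mat" and c :: "real vec"
    and Dg Df :: "real set" and g :: "real \<Rightarrow> real vec" and f :: "real \<Rightarrow> real"
  assumes n_ge_1: "n \<ge> 1"
    and g: "regularly_varying n B Dg g"
    and zero_diag: "\<forall>i<n. B $$ (i, i) = 0"
    and f: "Pi_class n B g Df f c"
begin

sublocale strictly_upper_triangular n B
  using g zero_diag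
  by unfold_locales (auto simp: regularly_varying_def index_matrix_def le_less upper_triangular_def)

lemma c_carrier: "c \<in> carrier_vec n"
  using f by (simp add: Pi_class_def)

lemma ev_carrier: "\<forall>\<^sub>F t in at_top. g t \<in> carrier_vec n"
proof -
  obtain t0 where "{t0..} \<subseteq> Dg" "\<forall>t\<in>Dg. g t \<in> carrier_vec n"
    using g by (auto simp: regularly_varying_def rate_vector_def nbhd_of_infinity_def)
  then show ?thesis
    by (intro eventually_at_top_linorderI[of t0]) auto
qed

lemma constant_sign: "i < n \<Longrightarrow> eventually_constant_sign (\<lambda>t. g t $ i)"
  using g by (simp add: regularly_varying_def rate_vector_def)

text \<open>Passes from vectors to components. As \<open>g t\<close> is known to have length
  \<open>n\<close> only for large \<open>t\<close>, the Landau statements are rewritten along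
  eventual equalities.\<close>

sublocale Pi_function n "\<lambda>i t. g t $ i" "exp_entry n B" f
  "\<lambda>j L. \<Sum>i<n. c $ i * exp_integral_entry n B i j L"
proof (rule Pi_function.intro)
  show scale: "regular_scale n (\<lambda>i t. g t $ i) (exp_entry n B)"
  proof
    show "0 < n"
      using n_ge_1 by simp
    show "\<forall>\<^sub>F t in at_top. g t $ i \<noteq> 0" if "i < n" for i
      using constant_sign[OF that] unfolding eventually_constant_sign_def
      by (elim disjE eventually_mono) auto
    show "(\<lambda>t. g t $ Suc i) \<in> o[at_top](\<lambda>t. g t $ i)" if "Suc i < n" for i
      using g that by (simp add: regularly_varying_def rate_vector_def)
    fix i and x :: real assume ix: "i < n" "x > 0"
    have "(\<lambda>t. (g (x * t) - mat_powr x B *\<^sub>v g t) $ i) \<in> o[at_top](\<lambda>t. g t $ (n - 1))"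
      using g ix by (simp add: regularly_varying_def vec_smallo_def)
    moreover have "\<forall>\<^sub>F t in at_top. (g (x * t) - mat_powr x B *\<^sub>v g t) $ i =
        g (x * t) $ i - (\<Sum>j<n. exp_entry n B i j (ln x) * g t $ j)"
      using ev_carrier
    proof eventually_elim
      case (elim t)
      moreover have "dim_vec (mat_powr x B *\<^sub>v g t) = n"
        using carrier by (simp add: mat_powr_def mat_exp_def)
      ultimately show ?case
        using ix by (simp add: mat_powr_mult_vec_nth del: index_mult_mat_vec dim_mult_mat_vec)
    qed
    ultimately show "(\<lambda>t. g (x * t) $ i - (\<Sum>j<n. exp_entry n B i j (ln x) * g t $ j))
        \<in> o[at_top](\<lambda>t. g t $ (n - 1))"
      by (simp only: landau_o.small.in_cong)
  qed (simp_all add: real_polynomial_function_exp_entry exp_entry_lower exp_entry_diag)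
  interpret regular_scale n "\<lambda>i t. g t $ i" "exp_entry n B"
    by (fact scale)
  show "Pi_function_axioms n (\<lambda>i t. g t $ i) f (\<lambda>j L. \<Sum>i<n. c $ i * exp_integral_entry n B i j L)"
  proof
    show "real_polynomial_function (\<lambda>L. \<Sum>i<n. c $ i * exp_integral_entry n B i j L)" for j
      by (intro real_polynomial_function_sum real_polynomial_function.intros(2,4)
          real_polynomial_function_exp_integral_entry) auto
    fix x :: real assume x: "x > 0"
    then have "(\<lambda>t. f (x * t) - (f t + Pi_rate n B c x \<bullet> g t)) \<in> o[at_top](\<lambda>t. g t $ (n - 1))"
      using f by (simp add: Pi_class_def)
    moreover have "\<forall>\<^sub>F t in at_top. f (x * t) - (f t + Pi_rate n B c x \<bullet> g t) = f (x * t) - f t -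
        (\<Sum>j<n. (\<Sum>i<n. c $ i * exp_integral_entry n B i j (ln x)) * g t $ j)"
      using ev_carrier by eventually_elim (simp add: Pi_rate_scalar_prod[OF c_carrier _ x])
    ultimately show "has_coeffs (\<lambda>t. f (x * t) - f t)
        (\<lambda>j. \<Sum>i<n. c $ i * exp_integral_entry n B i j (ln x))"
      unfolding has_coeffs_def by (simp only: landau_o.small.in_cong)
  qed
qed

text \<open>In column 0 of the integrated power only the diagonal entry survives, and at
  \<open>L = 1\<close> it equals 1, so the factor \<open>H 0 1\<close> of \<open>dcoeff_diag\<close>
  is \<open>c $ 0\<close>.\<close>

lemma dcoeff_diag_eq:
  assumes "i < n"
  shows "dcoeff i i = c $ 0 * (\<Prod>k<i. B $$ (k, k + 1))"
proof -
  have "(\<Sum>i<n. c $ i * exp_integral_entry n B i 0 1) = (\<Sum>i\<in>{0}. c $ i * exp_integral_entry n B i 0 1)"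
    using n_ge_1 by (intro sum.mono_neutral_right) (auto simp: exp_integral_entry_lower)
  also have "\<dots> = c $ 0"
    using n_ge_1 by (simp add: exp_integral_entry_diag)
  finally show ?thesis
    using assms by (simp add: dcoeff_diag exp_entry_superdiag)
qed

text \<open>The rows of Q are coefficient vectors of the differences, which are unique;
  triangularity then follows from \<open>dcoeff_lower\<close>. Hence Q itself is unique.\<close>

lemma Diff_expansion_iff:
  "Diff_expansion n g f Q \<longleftrightarrow> Q \<in> carrier_mat n n \<and> (\<forall>i<n. \<forall>j<n. Q $$ (i, j) = dcoeff i j)"
proof (cases "Q \<in> carrier_mat n n")
  case True
  have "(\<lambda>t. (Diff_vec n f t - Q *\<^sub>v g t) $ i) \<in> o[at_top](\<lambda>t. g t $ (n - 1)) \<longleftrightarrow>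
      has_coeffs (Diff (Suc i) f) (\<lambda>j. Q $$ (i, j))" if "i < n" for i
    unfolding has_coeffs_def
  proof (rule landau_o.small.in_cong)
    have dim: "dim_vec (Q *\<^sub>v g t) = n" for t
      using True by simp
    show "\<forall>\<^sub>F t in at_top. (Diff_vec n f t - Q *\<^sub>v g t) $ i =
        Diff (Suc i) f t - (\<Sum>j<n. Q $$ (i, j) * g t $ j)"
      using ev_carrier
      by eventually_elim (use that in \<open>simp add: Diff_vec_def dim mult_mat_vec_nth[OF True]
          del: index_mult_mat_vec dim_mult_mat_vec\<close>)
  qed
  moreover have "has_coeffs (Diff (Suc i) f) (\<lambda>j. Q $$ (i, j)) \<longleftrightarrow> (\<forall>j<n. Q $$ (i, j) = dcoeff i j)" for i
  proof
    assume "has_coeffs (Diff (Suc i) f) (\<lambda>j. Q $$ (i, j))"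
    from has_coeffs_unique[OF this has_coeffs_Diff] show "\<forall>j<n. Q $$ (i, j) = dcoeff i j"
      by blast
  next
    assume "\<forall>j<n. Q $$ (i, j) = dcoeff i j"
    then show "has_coeffs (Diff (Suc i) f) (\<lambda>j. Q $$ (i, j))"
      by (intro has_coeffs_cong[OF _ has_coeffs_Diff]) simp
  qed
  moreover have "upper_triangular Q" if "\<forall>i<n. \<forall>j<n. Q $$ (i, j) = dcoeff i j"
    using that True dcoeff_lower by (auto simp: upper_triangular_def)
  ultimately show ?thesis
    using True by (auto simp: Diff_expansion_def vec_smallo_def)
qed (simp add: Diff_expansion_def)

lemma Diff_expansion_exists: "\<exists>Q. Diff_expansion n g f Q"
  by (rule exI[of _ "mat n n (\<lambda>(i, j). dcoeff i j)"]) (simp add: Diff_expansion_iff)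

text \<open>A triangular matrix is invertible iff its diagonal has no zero. The last diagonal entry
  contains the factors of all the others, so it alone decides.\<close>

lemma invertible_iff:
  assumes "Diff_expansion n g f Q"
  shows "invertible_mat Q \<longleftrightarrow> c $ 0 * (\<Prod>i<n - 1. B $$ (i, i + 1)) \<noteq> 0"
    and "invertible_mat Q \<longleftrightarrow> (\<forall>i<n. dcoeff i i \<noteq> 0)"
proof -
  have "upper_triangular Q"
    using assms by (simp add: Diff_expansion_def)
  then show *: "invertible_mat Q \<longleftrightarrow> (\<forall>i<n. dcoeff i i \<noteq> 0)"
    using assms by (auto simp: Diff_expansion_iff invertible_upper_triangular_iff)
  show "invertible_mat Q \<longleftrightarrow> c $ 0 * (\<Prod>i<n - 1. B $$ (i, i + 1)) \<noteq> 0"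
  proof
    assume "invertible_mat Q"
    then have "dcoeff (n - 1) (n - 1) \<noteq> 0"
      using * n_ge_1 by simp
    then show "c $ 0 * (\<Prod>i<n - 1. B $$ (i, i + 1)) \<noteq> 0"
      using dcoeff_diag_eq[of "n - 1"] n_ge_1 by simp
  next
    assume "c $ 0 * (\<Prod>i<n - 1. B $$ (i, i + 1)) \<noteq> 0"
    then show "invertible_mat Q"
      unfolding * by (auto simp: dcoeff_diag_eq)
  qed
qed

text \<open>Signs and orders come from the leading terms. The rescaling relation is (b) for positive
  orders, since row \<open>i\<close> of the power of \<open>Diff_index_mat n\<close> consists of the
  binomial coefficients in (b).\<close>

lemma Diff_regularly_varying:
  assumes nz: "\<forall>i<n. dcoeff i i \<noteq> 0"
  shows "regularly_varying n (Diff_index_mat n) (Diff_dom n Df) (Diff_vec n f)"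
proof -
  interpret M: strictly_upper_triangular n "Diff_index_mat n"
    by (rule strictly_upper_triangular_Diff_index_mat)
  have carr: "Diff_vec n f t \<in> carrier_vec n" for t
    by (simp add: Diff_vec_def)
  have Df: "nbhd_of_infinity Df" "lebesgue_measurable_fun Df f"
    using f by (simp_all add: Pi_class_def)
  have "rate_vector n (Diff_dom n Df) (Diff_vec n f)"
    unfolding rate_vector_def
  proof (intro conjI allI impI ballI)
    show "nbhd_of_infinity (Diff_dom n Df)"
      using Df(1) by (rule nbhd_of_infinity_Diff_dom)
    show "eventually_constant_sign (\<lambda>t. Diff_vec n f t $ i)" if "i < n" for i
      using Diff_constant_sign[OF that _ constant_sign[OF that]] nz that
      by (simp add: Diff_vec_def del: Diff.simps)
    show "(\<lambda>t. Diff_vec n f t $ (i + 1)) \<in> o[at_top](\<lambda>t. Diff_vec n f t $ i)" if "i + 1 < n" for i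
      using Diff_Suc_small[of i] nz that by (simp add: Diff_vec_def del: Diff.simps dcoeff.simps)
  qed (rule carr)
  moreover have "lebesgue_measurable_fun (Diff_dom n Df) (\<lambda>t. Diff_vec n f t $ i)" if "i < n" for i
  proof -
    have "Diff_dom n Df \<in> sets lebesgue"
      using lebesgue_measurable_fun_Diff[OF Df(2), of n] by (simp add: lebesgue_measurable_fun_def)
    then have "lebesgue_measurable_fun (Diff_dom n Df) (Diff (Suc i) f)"
      using that by (intro lebesgue_measurable_fun_subset[OF lebesgue_measurable_fun_Diff[OF Df(2)]]
          Diff_dom_antimono) auto
    then show ?thesis
      using that by (simp add: Diff_vec_def del: Diff.simps)
  qed
  moreover have "(\<lambda>t. (Diff_vec n f (x * t) - mat_powr x (Diff_index_mat n) *\<^sub>v Diff_vec n f t) $ i)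
      \<in> o[at_top](\<lambda>t. Diff_vec n f t $ (n - 1))" if "x > 0" "i < n" for x i
  proof -
    have "(mat_powr x (Diff_index_mat n) *\<^sub>v Diff_vec n f t) $ i =
        (\<Sum>j=Suc i..n. (ln x gchoose (j - Suc i)) * Diff j f t)" for t
    proof -
      have "(mat_powr x (Diff_index_mat n) *\<^sub>v Diff_vec n f t) $ i =
          (\<Sum>j\<in>{i..<n}. (ln x gchoose (j - i)) * Diff (Suc j) f t)"
        unfolding M.mat_powr_mult_vec_nth[OF carr that(2)] using that(2)
        by (intro sum.mono_neutral_cong_right)
          (auto simp: exp_entry_Diff_index_mat Diff_vec_def simp del: Diff.simps split: if_splits)
      also have "\<dots> = (\<Sum>j=Suc i..n. (ln x gchoose (j - Suc i)) * Diff j f t)"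
        by (rule sum.reindex_bij_witness[of _ "\<lambda>j. j - 1" Suc]) (auto simp del: Diff.simps)
      finally show ?thesis .
    qed
    moreover have "dim_vec (mat_powr x (Diff_index_mat n) *\<^sub>v Diff_vec n f t) = n" for t
      using M.carrier by (simp add: mat_powr_def mat_exp_def)
    ultimately have "(\<lambda>t. (Diff_vec n f (x * t) - mat_powr x (Diff_index_mat n) *\<^sub>v Diff_vec n f t) $ i) =
        (\<lambda>t. Diff (Suc i) f (x * t) - (\<Sum>j=Suc i..n. (ln x gchoose (j - Suc i)) * Diff j f t))"
      using that by (simp add: Diff_vec_def del: Diff.simps index_mult_mat_vec dim_mult_mat_vec)
    moreover have "(\<lambda>t. Diff_vec n f t $ (n - 1)) = Diff n f"
      using n_ge_1 by (simp add: Diff_vec_def del: Diff.simps)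
    ultimately show ?thesis
      using Diff_expansion_binomial[of "Suc i" x] that nz n_ge_1
      by (simp only:) (intro negligible_imp_small_Diff; simp del: Diff.simps)
  qed
  ultimately show ?thesis
    using index_matrix_strictly_upper_triangular[OF M.strictly_upper_triangular_axioms]
    by (simp add: regularly_varying_def vec_smallo_def)
qed

text \<open>This is (b) for order 0, with the error measured against the last difference.\<close>

lemma Diff_Pi_class:
  assumes nz: "\<forall>i<n. dcoeff i i \<noteq> 0"
  shows "Pi_class n (Diff_index_mat n) (Diff_vec n f) Df f (Diff_index_vec n)"
proof -
  interpret M: strictly_upper_triangular n "Diff_index_mat n"
    by (rule strictly_upper_triangular_Diff_index_mat)
  have carr: "Diff_vec n f t \<in> carrier_vec n" "Diff_index_vec n \<in> carrier_vec n" for t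
    by (simp_all add: Diff_vec_def Diff_index_vec_def)
  have "(\<lambda>t. f (x * t) - (f t + Pi_rate n (Diff_index_mat n) (Diff_index_vec n) x \<bullet> Diff_vec n f t))
      \<in> o[at_top](\<lambda>t. Diff_vec n f t $ (n - 1))" if x: "x > 0" for x
  proof -
    have "f t + Pi_rate n (Diff_index_mat n) (Diff_index_vec n) x \<bullet> Diff_vec n f t =
        (\<Sum>j=0..n. (ln x gchoose (j - 0)) * Diff j f t)" for t
    proof -
      have "Pi_rate n (Diff_index_mat n) (Diff_index_vec n) x \<bullet> Diff_vec n f t =
          (\<Sum>j<n. (ln x gchoose Suc j) * Diff (Suc j) f t)"
        unfolding M.Pi_rate_scalar_prod[OF carr(2,1) x]
        by (intro sum.cong) (auto simp: exp_integral_entry_Diff_index_mat Diff_vec_def simp del: Diff.simps)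
      then show ?thesis
        by (simp add: atLeast0AtMost sum.atMost_shift del: Diff.simps(2))
    qed
    moreover have "(\<lambda>t. Diff_vec n f t $ (n - 1)) = Diff n f"
      using n_ge_1 by (simp add: Diff_vec_def del: Diff.simps)
    ultimately show ?thesis
      using negligible_imp_small_Diff[OF _ Diff_expansion_binomial[of 0 x]] x nz n_ge_1 by simp
  qed
  then show ?thesis
    using f carr by (simp add: Pi_class_def)
qed

end

theorem theorem5p5:
  fixes n :: nat and B :: "real mat" and c :: "real vec"
    and Dg Df :: "real set" and g :: "real \<Rightarrow> real vec" and f :: "real \<Rightarrow> real"
  assumes "n \<ge> 1"
    and "regularly_varying n B Dg g"
    and "\<forall>i<n. B $$ (i, i) = 0"
    and "Pi_class n B g Df f c"
  shows "(\<exists>Q. Diff_expansion n g f Q) \<and>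
    (\<forall>i\<le>n. \<forall>x>0.
       (\<lambda>t. Diff i f (x * t) - (\<Sum>j=i..n. (ln x gchoose (j - i)) * Diff j f t))
         \<in> o[at_top](\<lambda>t. g t $ (n - 1))) \<and>
    (\<forall>Q. Diff_expansion n g f Q \<longrightarrow>
       (invertible_mat Q \<longleftrightarrow> c $ 0 * (\<Prod>i<n - 1. B $$ (i, i + 1)) \<noteq> 0) \<and>
       (invertible_mat Q \<longrightarrow>
          regularly_varying n (Diff_index_mat n) (Diff_dom n Df) (Diff_vec n f) \<and>
          Pi_class n (Diff_index_mat n) (Diff_vec n f) Df f (Diff_index_vec n)))"
proof -
  interpret Pi_class_zero_diag n B c Dg Df g f
    by unfold_locales (fact assms)+
  show ?thesis
    using Diff_expansion_exists Diff_expansion_binomial invertible_iff Diff_regularly_varying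
      Diff_Pi_class by blast
qed

end
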